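(* Consider the plant $x_{k+1}=A_px_k+B_pu_k$, $y_k=C_px_k$ with $x_k\in\mathbb{R}^n$, $u_k\in\mathbb{R}^m$, $y_k\in\mathbb{R}^p$, in feedback with the bias-free static implicit controller $$\eta_k=\phi(W\eta_k+Uy_k),\qquad u_k=Ky_k+V\eta_k,\qquad \eta_k\in\mathbb{R}^q.$$ Suppose that $\phi$ is componentwise nonexpansive, that $\phi$ satisfies the static sector condition with diagonal matrices $D_0,D_1$, and that $\lambda_{\mathrm{pf}}(|W|)<1$. If there exist $P\succ0$ in $\mathbb{R}^{n\times n}$, a diagonal $\Lambda\succeq0$ in $\mathbb{R}^{q\times q}$, and $\rho\in[0,1)$ such that $$F^\top PF-\rho^2X^\top PX+M_\Lambda\preceq0,$$ then the origin of the closed loop is globally exponentially stable; more precisely, every closed-loop trajectory satisfies $$x_k^\top Px_k\le\rho^{2k}x_0^\top Px_0,\qquad k=0,1,2,\ldots.$$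
   Context: Componentwise nonexpansive: $\phi:\mathbb{R}^q\to\mathbb{R}^q$ acts componentwise, $\phi(r)_i=\phi_i(r_i)$, and $|\phi(r)-\phi(s)|\le|r-s|$ for all $r,s$, with componentwise absolute values and inequalities. Static sector condition: $\phi(0)=0$ and there are diagonal matrices $D_0=\mathrm{diag}(\underline m_i)$, $D_1=\mathrm{diag}(\overline m_i)$ with $0\le\underline m_i\le\overline m_i\le1$ such that $(\phi_i(z_i)-\underline m_iz_i)(\overline m_iz_i-\phi_i(z_i))\ge0$ for all $z_i\in\mathbb{R}$, $i=1,\dots,q$. Notation: $X=[I_n\;\;0]\in\mathbb{R}^{n\times(n+q)}$, $H=[0\;\;I_q]\in\mathbb{R}^{q\times(n+q)}$, $Z=[UC_p\;\;W]$, $F=[A_p+B_pKC_p\;\;B_pV]$, and $$M_\Lambda=-2Z^\top D_0\Lambda D_1Z+\mathrm{He}\big(H^\top\Lambda(D_0+D_1)Z\big)-2H^\top\Lambda H,$$ where $\mathrm{He}(Y)=Y+Y^\top$. $P\succ0$ means symmetric positive definite; $\preceq,\succeq$ denote the semidefinite order. $|W|$ is the componentwise absolute value and $\lambda_{\mathrm{pf}}(|W|)$ is the Perron--Frobenius eigenvalue (spectral radius) of the nonnegative matrix $|W|$. All matrices are real of compatible dimensions. At each time, $\eta_k$ is the (unique) solution of the algebraic fixed-point equation for the current $y_k$. *)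

theory Defs
  imports "HOL-Analysis.Analysis"
begin

text \<open>
  A matrix in \<open>\<real>\<^sup>r\<^sup>\<times>\<^sup>c\<close> has type \<^typ>\<open>real ^ 'c ^ 'r\<close>. A block row \<open>[A B]\<close> has its columns
  indexed by the sum of the two column index types.
\<close>

definition block_row :: "real ^ 'a ^ 'r \<Rightarrow> real ^ 'b ^ 'r \<Rightarrow> real ^ ('a + 'b) ^ 'r" where
  "block_row A B = (\<chi> i j. case j of Inl a \<Rightarrow> A $ i $ a | Inr b \<Rightarrow> B $ i $ b)"

definition He :: "real ^ 'a ^ 'a \<Rightarrow> real ^ 'a ^ 'a" where
  "He Y = Y + transpose Y"

definition is_diagonal :: "real ^ 'a ^ 'a \<Rightarrow> bool" where
  "is_diagonal D \<longleftrightarrow> (\<forall>i j. i \<noteq> j \<longrightarrow> D $ i $ j = 0)"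

definition pos_def :: "real ^ 'a ^ 'a \<Rightarrow> bool" where
  "pos_def P \<longleftrightarrow> transpose P = P \<and> (\<forall>v. v \<noteq> 0 \<longrightarrow> v \<bullet> (P *v v) > 0)"

definition pos_semidef :: "real ^ 'a ^ 'a \<Rightarrow> bool" where
  "pos_semidef P \<longleftrightarrow> transpose P = P \<and> (\<forall>v. v \<bullet> (P *v v) \<ge> 0)"

text \<open>The semidefinite order; the library order \<open>\<le>\<close> on matrices is entrywise.\<close>

definition semidef_le :: "real ^ 'a ^ 'a \<Rightarrow> real ^ 'a ^ 'a \<Rightarrow> bool"  (infix "\<preceq>\<^sub>L" 50) where
  "A \<preceq>\<^sub>L B \<longleftrightarrow> pos_semidef (B - A)"

definition complex_eigenvalue :: "real ^ 'a ^ 'a \<Rightarrow> complex \<Rightarrow> bool" where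
  "complex_eigenvalue A c \<longleftrightarrow>
     (\<exists>v :: complex ^ 'a. v \<noteq> 0 \<and> (\<chi> i j. complex_of_real (A $ i $ j)) *v v = c *s v)"

text \<open>
  The spectral radius, which is the Perron--Frobenius eigenvalue when the matrix is entrywise
  nonnegative. The set is finite and nonempty because index types are finite and nonempty.
\<close>

definition lambda_pf :: "real ^ 'a ^ 'a \<Rightarrow> real" where
  "lambda_pf A = Max (cmod ` {c. complex_eigenvalue A c})"

text \<open>
  The map \<open>\<phi>\<close> on vectors is given together with its scalar components \<open>\<phi>c i\<close>. Order and absolute
  value on \<^typ>\<open>real ^ 'q\<close> are componentwise.
\<close>

definition acts_componentwise :: "(real ^ 'q \<Rightarrow> real ^ 'q) \<Rightarrow> ('q \<Rightarrow> real \<Rightarrow> real) \<Rightarrow> bool" where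
  "acts_componentwise \<phi> \<phi>c \<longleftrightarrow> (\<forall>r i. \<phi> r $ i = \<phi>c i (r $ i))"

definition componentwise_nonexpansive ::
    "(real ^ 'q \<Rightarrow> real ^ 'q) \<Rightarrow> ('q \<Rightarrow> real \<Rightarrow> real) \<Rightarrow> bool" where
  "componentwise_nonexpansive \<phi> \<phi>c \<longleftrightarrow>
     acts_componentwise \<phi> \<phi>c \<and> (\<forall>r s. \<bar>\<phi> r - \<phi> s\<bar> \<le> \<bar>r - s\<bar>)"

definition static_sector_condition ::
    "(real ^ 'q \<Rightarrow> real ^ 'q) \<Rightarrow> ('q \<Rightarrow> real \<Rightarrow> real) \<Rightarrow> real ^ 'q ^ 'q \<Rightarrow> real ^ 'q ^ 'q \<Rightarrow> bool" where
  "static_sector_condition \<phi> \<phi>c D\<^sub>0 D\<^sub>1 \<longleftrightarrow>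
     \<phi> 0 = 0 \<and> is_diagonal D\<^sub>0 \<and> is_diagonal D\<^sub>1 \<and>
     (\<forall>i. 0 \<le> D\<^sub>0 $ i $ i \<and> D\<^sub>0 $ i $ i \<le> D\<^sub>1 $ i $ i \<and> D\<^sub>1 $ i $ i \<le> 1) \<and>
     (\<forall>i z. (\<phi>c i z - D\<^sub>0 $ i $ i * z) * (D\<^sub>1 $ i $ i * z - \<phi>c i z) \<ge> 0)"

text \<open>The equations of plant and controller, with the fixed-point equation kept implicit.\<close>

definition closed_loop_trajectory ::
    "real ^ 'n ^ 'n \<Rightarrow> real ^ 'm ^ 'n \<Rightarrow> real ^ 'n ^ 'p \<Rightarrow>
     real ^ 'p ^ 'm \<Rightarrow> real ^ 'p ^ 'q \<Rightarrow> real ^ 'q ^ 'm \<Rightarrow> real ^ 'q ^ 'q \<Rightarrow> (real ^ 'q \<Rightarrow> real ^ 'q) \<Rightarrow>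
     (nat \<Rightarrow> real ^ 'n) \<Rightarrow> (nat \<Rightarrow> real ^ 'm) \<Rightarrow> (nat \<Rightarrow> real ^ 'p) \<Rightarrow> (nat \<Rightarrow> real ^ 'q) \<Rightarrow> bool" where
  "closed_loop_trajectory A\<^sub>p B\<^sub>p C\<^sub>p K U V W \<phi> x u y \<eta> \<longleftrightarrow>
     (\<forall>k. x (Suc k) = A\<^sub>p *v x k + B\<^sub>p *v u k \<and>
          y k = C\<^sub>p *v x k \<and>
          \<eta> k = \<phi> (W *v \<eta> k + U *v y k) \<and>
          u k = K *v y k + V *v \<eta> k)"

text \<open>
  The same closed loop as an autonomous system \<open>x\<^sub>k\<^sub>+\<^sub>1 = f(x\<^sub>k)\<close>, where \<open>\<eta>\<^sub>k\<close> is the unique solution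
  of the fixed-point equation for the current output.
\<close>

definition implicit_output ::
    "real ^ 'p ^ 'q \<Rightarrow> real ^ 'q ^ 'q \<Rightarrow> (real ^ 'q \<Rightarrow> real ^ 'q) \<Rightarrow> real ^ 'p \<Rightarrow> real ^ 'q" where
  "implicit_output U W \<phi> y = (THE \<eta>. \<eta> = \<phi> (W *v \<eta> + U *v y))"

definition closed_loop_map ::
    "real ^ 'n ^ 'n \<Rightarrow> real ^ 'm ^ 'n \<Rightarrow> real ^ 'n ^ 'p \<Rightarrow>
     real ^ 'p ^ 'm \<Rightarrow> real ^ 'p ^ 'q \<Rightarrow> real ^ 'q ^ 'm \<Rightarrow> real ^ 'q ^ 'q \<Rightarrow> (real ^ 'q \<Rightarrow> real ^ 'q) \<Rightarrow>
     real ^ 'n \<Rightarrow> real ^ 'n" where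
  "closed_loop_map A\<^sub>p B\<^sub>p C\<^sub>p K U V W \<phi> x =
     A\<^sub>p *v x + B\<^sub>p *v (K *v (C\<^sub>p *v x) + V *v implicit_output U W \<phi> (C\<^sub>p *v x))"

definition origin_globally_exponentially_stable :: "(real ^ 'n \<Rightarrow> real ^ 'n) \<Rightarrow> bool" where
  "origin_globally_exponentially_stable f \<longleftrightarrow>
     f 0 = 0 \<and>
     (\<exists>c \<gamma>. c > 0 \<and> 0 < \<gamma> \<and> \<gamma> < 1 \<and>
        (\<forall>x. (\<forall>k. x (Suc k) = f (x k)) \<longrightarrow> (\<forall>k. norm (x k) \<le> c * \<gamma> ^ k * norm (x 0))))"

definition state_selector :: "real ^ ('n + 'q::finite) ^ 'n" where
  "state_selector = block_row (mat 1) 0"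

definition activation_selector :: "real ^ ('n::finite + 'q) ^ 'q" where
  "activation_selector = block_row 0 (mat 1)"

definition sector_multiplier ::
    "real ^ 'q ^ 'q \<Rightarrow> real ^ 'q ^ 'q \<Rightarrow> real ^ 'q ^ 'q \<Rightarrow> real ^ ('n::finite + 'q) ^ 'q \<Rightarrow>
     real ^ ('n + 'q) ^ ('n + 'q)" where
  "sector_multiplier D\<^sub>0 D\<^sub>1 \<Lambda> Z =
     (let H = activation_selector in
      (- 2) *\<^sub>R (transpose Z ** D\<^sub>0 ** \<Lambda> ** D\<^sub>1 ** Z)
      + He (transpose H ** \<Lambda> ** (D\<^sub>0 + D\<^sub>1) ** Z)
      - 2 *\<^sub>R (transpose H ** \<Lambda> ** H))"

end

theory Submission
  imports Defs "HOL-Computational_Algebra.Polynomial"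
begin

text \<open>
  On a closed-loop step, the sector condition makes the quadratic form of \<open>M\<^sub>\<Lambda>\<close> nonnegative at
  \<open>(x, \<eta>)\<close>, so the matrix inequality yields \<open>V(x\<^sub>k\<^sub>+\<^sub>1) \<le> \<rho>\<^sup>2 V(x\<^sub>k)\<close> for \<open>V(x) = x\<^sup>\<top> P x\<close>. The
  fixed-point equation for \<open>\<eta>\<close> is well posed because the spectral radius condition forces every
  \<open>d \<ge> 0\<close> with \<open>d \<le> \<bar>W\<bar> d\<close> to vanish: this gives uniqueness directly, and it gives a solution
  \<open>v \<ge> 0\<close> of \<open>v = \<bar>W\<bar> v + a\<close>, hence an invariant box for Brouwer's theorem.
\<close>

section \<open>Nonnegative matrices with spectral radius below one\<close>

text \<open>A square matrix is singular exactly when its kernel is nontrivial. This turns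
  eigenvalues into zeros of a polynomial in \<open>c\<close>.\<close>

lemma complex_eigenvalue_iff_det:
  "complex_eigenvalue A c \<longleftrightarrow>
     det ((\<chi> i j. complex_of_real (A $ i $ j)) - mat c) = 0"
proof -
  let ?M = "(\<chi> i j. complex_of_real (A $ i $ j)) :: complex ^ 'a ^ 'a"
  have *: "(?M - mat c) *v v = ?M *v v - c *s v" for v
  proof -
    have "mat c *v v = c *s v"
      by (simp add: vec_eq_iff matrix_vector_mult_def mat_def if_distrib if_distribR
          sum.delta' cong: if_cong)
    then show ?thesis by (simp add: matrix_vector_mult_diff_rdistrib)
  qed
  have "det (?M - mat c) = 0 \<longleftrightarrow> \<not> (\<exists>B. B ** (?M - mat c) = mat 1)"
    using invertible_det_nz invertible_left_inverse by blast
  also have "\<dots> \<longleftrightarrow> (\<exists>v. v \<noteq> 0 \<and> (?M - mat c) *v v = 0)"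
    using matrix_left_invertible_ker by blast
  also have "\<dots> \<longleftrightarrow> complex_eigenvalue A c"
    unfolding complex_eigenvalue_def * by simp
  finally show ?thesis ..
qed

text \<open>Read the eigenvector equation at a component of largest modulus and divide by that
  modulus. The crude bound serves only to exhibit a number that is not an eigenvalue.\<close>

lemma complex_eigenvalue_bound:
  assumes "complex_eigenvalue A c"
  shows "cmod c \<le> (\<Sum>i\<in>UNIV. \<Sum>j\<in>UNIV. \<bar>A $ i $ j\<bar>)"
proof -
  obtain v :: "complex ^ 'a" where "v \<noteq> 0"
    and v: "(\<chi> i j. complex_of_real (A $ i $ j)) *v v = c *s v"
    using assms unfolding complex_eigenvalue_def by blast
  have "Max (range (\<lambda>i. cmod (v $ i))) \<in> range (\<lambda>i. cmod (v $ i))" by (rule Max_in) auto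
  then obtain m where m: "\<And>i. cmod (v $ i) \<le> cmod (v $ m)"
    by (metis (no_types, lifting) Max_ge finite_class.finite_UNIV finite_imageI rangeE rangeI)
  have pos: "0 < cmod (v $ m)"
  proof (rule ccontr)
    assume "\<not> 0 < cmod (v $ m)"
    then have "v $ i = 0" for i
      using m[of i] by (metis norm_le_zero_iff not_le order_trans)
    with \<open>v \<noteq> 0\<close> show False by (simp add: vec_eq_iff)
  qed
  have "c * v $ m = (\<Sum>j\<in>UNIV. complex_of_real (A $ m $ j) * v $ j)"
    using arg_cong[OF v, of "\<lambda>x. x $ m"] by (simp add: matrix_vector_mult_def)
  then have "cmod c * cmod (v $ m) = cmod (\<Sum>j\<in>UNIV. complex_of_real (A $ m $ j) * v $ j)"
    by (metis norm_mult)
  also have "\<dots> \<le> (\<Sum>j\<in>UNIV. \<bar>A $ m $ j\<bar> * cmod (v $ m))"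
    by (rule sum_norm_le) (simp add: norm_mult m mult_left_mono)
  also have "\<dots> = (\<Sum>j\<in>UNIV. \<bar>A $ m $ j\<bar>) * cmod (v $ m)" by (simp add: sum_distrib_right)
  finally have "cmod c \<le> (\<Sum>j\<in>UNIV. \<bar>A $ m $ j\<bar>)" using pos by simp
  also have "\<dots> \<le> (\<Sum>i\<in>UNIV. \<Sum>j\<in>UNIV. \<bar>A $ i $ j\<bar>)"
    by (rule member_le_sum) (auto intro: sum_nonneg)
  finally show ?thesis .
qed

text \<open>Eigenvalues are the roots of the characteristic polynomial. Finiteness is what makes the
  \<open>Max\<close> in \<open>lambda_pf\<close> an upper bound.\<close>

lemma finite_complex_eigenvalues: "finite {c. complex_eigenvalue A c}"
proof -
  \<comment> \<open>The entries are linear polynomials, constant off the diagonal, so evaluating the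
    determinant at \<open>c\<close> gives the determinant of \<open>A - c I\<close>.\<close>
  define p where "p = det (\<chi> i j. [:complex_of_real (A $ i $ j), - (if i = j then 1 else 0):])"
  have p: "poly p c = det ((\<chi> i j. complex_of_real (A $ i $ j)) - mat c)" for c
    unfolding p_def det_def
    by (simp add: poly_sum poly_prod mat_def if_distrib cong: if_cong)
       (auto intro!: sum.cong prod.cong arg_cong2[where f = "(*)"] simp: sign_def)
  define b where "b = (\<Sum>i\<in>UNIV. \<Sum>j\<in>UNIV. \<bar>A $ i $ j\<bar>)"
  have "0 \<le> b" unfolding b_def by (intro sum_nonneg) auto
  \<comment> \<open>\<open>b + 1\<close> lies beyond the eigenvalue bound, so \<open>p\<close> does
    not vanish there and is not the zero polynomial.\<close>
  then have "\<not> complex_eigenvalue A (of_real (b + 1))"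
    using complex_eigenvalue_bound[of A "of_real (b + 1)"] unfolding b_def[symmetric] norm_of_real by auto
  then have "p \<noteq> 0" using p complex_eigenvalue_iff_det by (metis poly_0)
  then have "finite {c. poly p c = 0}" by (rule poly_roots_finite)
  then show ?thesis by (simp add: complex_eigenvalue_iff_det p)
qed

text \<open>A real eigenvector, embedded entrywise, is a complex one, and \<open>r\<close> is at
  most its modulus. Everything below uses the spectral radius only through this comparison.\<close>

lemma real_eigenvalue_le_lambda_pf:
  assumes "A *v v = r *\<^sub>R v" and "v \<noteq> 0"
  shows "r \<le> lambda_pf A"
proof -
  define w :: "complex ^ 'a" where "w = (\<chi> i. complex_of_real (v $ i))"
  have "w \<noteq> 0" using assms(2) by (auto simp: w_def vec_eq_iff)
  moreover have "(\<chi> i j. complex_of_real (A $ i $ j)) *v w = of_real r *s w"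
  proof -
    have "(\<Sum>j\<in>UNIV. A $ i $ j * v $ j) = r * v $ i" for i
      using arg_cong[OF assms(1), of "\<lambda>x. x $ i"] by (simp add: matrix_vector_mult_def)
    then show ?thesis
      by (simp add: w_def vec_eq_iff matrix_vector_mult_def flip: of_real_mult of_real_sum)
  qed
  ultimately have "complex_eigenvalue A (of_real r)" unfolding complex_eigenvalue_def by blast
  then have "cmod (of_real r) \<le> lambda_pf A"
    unfolding lambda_pf_def by (intro Max_ge imageI finite_imageI) (simp_all add: finite_complex_eigenvalues)
  then show ?thesis by simp
qed

lemma nonneg_matrix_vector_mono:
  fixes A :: "real ^ 'a ^ 'b"
  assumes "0 \<le> A" and "v \<le> w"
  shows "A *v v \<le> A *v w"
  using assms by (auto simp: less_eq_vec_def matrix_vector_mult_def intro!: sum_mono mult_left_mono)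

text \<open>
  The normalized map \<open>v \<mapsto> A v / \<Sum>(A v)\<close> preserves the compact convex set of probability vectors
  with \<open>v \<le> A v\<close>; a Brouwer fixed point there is an eigenvector with eigenvalue at least one.
\<close>

lemma subinvariant_vector_eq_0:
  fixes A :: "real ^ 'q ^ 'q"
  assumes "0 \<le> A" and "lambda_pf A < 1" and "0 \<le> d" and "d \<le> A *v d"
  shows "d = 0"
proof (rule ccontr)
  assume "d \<noteq> 0"
  define tot where "tot = (\<lambda>v :: real ^ 'q. \<Sum>i\<in>UNIV. v $ i)"
  have tot_scale: "tot (c *\<^sub>R v) = c * tot v" for c v
    by (simp add: tot_def sum_distrib_left)
  have tot_mono: "v \<le> w \<Longrightarrow> tot v \<le> tot w" for v w
    by (auto simp: tot_def less_eq_vec_def intro: sum_mono)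
  have cont_tot: "continuous_on UNIV tot"
    unfolding tot_def by (intro continuous_intros)
  have cont_A: "continuous_on UNIV ((*v) A)"
    by (intro linear_continuous_on matrix_vector_mul_bounded_linear)
  define S where "S = {v. 0 \<le> v} \<inter> {v. tot v = 1} \<inter> {v. v \<le> A *v v}"
  have "0 < tot d"
  proof -
    have "\<And>i. 0 \<le> d $ i" using assms(3) by (simp add: less_eq_vec_def)
    moreover obtain i where "d $ i \<noteq> 0" using \<open>d \<noteq> 0\<close> by (auto simp: vec_eq_iff)
    ultimately show ?thesis unfolding tot_def
      by (intro sum_pos2[of _ i]) (auto simp: order_less_le)
  qed
  have scale_le: "v \<le> w \<Longrightarrow> 0 \<le> c \<Longrightarrow> c *\<^sub>R v \<le> c *\<^sub>R w" for v w :: "real ^ 'q" and c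
    by (auto simp: less_eq_vec_def mult_left_mono)
  have "(1 / tot d) *\<^sub>R d \<in> S"
    using assms(3) \<open>0 < tot d\<close> scale_le[OF assms(4), of "1 / tot d"] scale_le[OF assms(3), of "1 / tot d"]
    by (simp add: S_def tot_scale matrix_vector_mult_scaleR)
  then have "S \<noteq> {}" by blast
  moreover have "convex S"
  proof (rule convexI)
    fix x y :: "real ^ 'q" and u v :: real
    assume *: "x \<in> S" "y \<in> S" "0 \<le> u" "0 \<le> v" "u + v = 1"
    have "tot (u *\<^sub>R x + v *\<^sub>R y) = u * tot x + v * tot y"
      by (simp add: tot_def sum.distrib sum_distrib_left)
    moreover have "A *v (u *\<^sub>R x + v *\<^sub>R y) = u *\<^sub>R (A *v x) + v *\<^sub>R (A *v y)"
      by (simp add: matrix_vector_right_distrib matrix_vector_mult_scaleR)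
    ultimately show "u *\<^sub>R x + v *\<^sub>R y \<in> S"
      using * scale_le[of 0 x u] scale_le[of 0 y v] scale_le[of x "A *v x" u] scale_le[of y "A *v y" v]
      by (auto simp: S_def intro: add_mono)
  qed
  moreover have "compact S"
  proof -
    have "closed S"
      unfolding S_def less_eq_vec_def using cont_tot cont_A
      by (intro closed_Int closed_Collect_eq closed_Collect_all closed_Collect_le continuous_intros)
         auto
    moreover have "S \<subseteq> cbox 0 1"
    proof
      fix v assume v: "v \<in> S"
      then have "0 \<le> v $ i" for i by (simp add: S_def less_eq_vec_def)
      moreover from this have "v $ i \<le> tot v" for i
        unfolding tot_def by (intro member_le_sum) auto
      ultimately show "v \<in> cbox 0 1"
        using v by (auto simp: mem_box_cart S_def)
    qed
    ultimately show ?thesis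
      by (meson bounded_cbox bounded_subset compact_eq_bounded_closed)
  qed
  moreover define f where "f = (\<lambda>v. (1 / tot (A *v v)) *\<^sub>R (A *v v))"
  \<comment> \<open>This bound serves twice: the normalization in \<open>f\<close> never divides by
    zero, and the eigenvalue found at the end is at least one.\<close>
  have ge1: "1 \<le> tot (A *v v)" if "v \<in> S" for v
    using that tot_mono[of v "A *v v"] by (auto simp: S_def)
  have "continuous_on S f"
  proof -
    have "continuous_on S (\<lambda>v. tot (A *v v))"
      using continuous_on_compose2[OF cont_tot cont_A] continuous_on_subset by blast
    moreover have "continuous_on S ((*v) A)" using cont_A continuous_on_subset by blast
    ultimately show ?thesis unfolding f_def
      by (intro continuous_intros) (use ge1 in force)+
  qed
  moreover have "f ` S \<subseteq> S"
  proof (rule image_subsetI)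
    fix v assume v: "v \<in> S"
    then have 1: "v \<le> A *v v" "0 \<le> A *v v" by (auto simp: S_def)
    \<comment> \<open>Monotonicity of \<open>A\<close> carries \<open>v \<le> A v\<close> over to
      the image, which is why \<open>f\<close> preserves that constraint of
      \<open>S\<close>.\<close>
    then have 2: "A *v v \<le> A *v (A *v v)" by (intro nonneg_matrix_vector_mono[OF assms(1)])
    show "f v \<in> S"
      using ge1[OF v] scale_le[OF 1(2), of "1 / tot (A *v v)"] scale_le[OF 2, of "1 / tot (A *v v)"]
      by (simp add: S_def f_def tot_scale matrix_vector_mult_scaleR)
  qed
  ultimately obtain v where v: "v \<in> S" "f v = v"
    using brouwer[of S f] by (auto simp: image_subset_iff_funcset)
  have "tot (A *v v) *\<^sub>R f v = A *v v"
    using ge1[OF v(1)] unfolding f_def by simp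
  then have "A *v v = tot (A *v v) *\<^sub>R v" using v(2) by simp
  moreover have "v \<noteq> 0" using v(1) by (auto simp: S_def tot_def)
  ultimately show False
    using real_eigenvalue_le_lambda_pf assms(2) ge1[OF v(1)] by fastforce
qed

lemma abs_matrix_vector_le:
  fixes W :: "real ^ 'a ^ 'b"
  shows "\<bar>W *v v\<bar> \<le> \<bar>W\<bar> *v \<bar>v\<bar>"
  unfolding less_eq_vec_def
proof
  fix i
  have "\<bar>\<Sum>j\<in>UNIV. W $ i $ j * v $ j\<bar> \<le> (\<Sum>j\<in>UNIV. \<bar>W $ i $ j * v $ j\<bar>)"
    by (rule sum_abs)
  then show "\<bar>W *v v\<bar> $ i \<le> (\<bar>W\<bar> *v \<bar>v\<bar>) $ i"
    by (simp add: matrix_vector_mult_def abs_vec_def abs_mult)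
qed

text \<open>
  Subinvariance of \<open>\<bar>v\<bar>\<close> for a kernel vector of \<open>1 - A\<close> makes \<open>1 - A\<close> invertible, and subinvariance of
  the negative part of the solution makes the solution nonnegative.
\<close>

lemma nonneg_resolvent:
  fixes A :: "real ^ 'q ^ 'q"
  assumes A: "0 \<le> A" "lambda_pf A < 1" and "0 \<le> a"
  obtains v where "0 \<le> v" and "v = A *v v + a"
proof -
  have [simp]: "\<bar>A\<bar> = A" using A(1) by (simp add: vec_eq_iff abs_vec_def less_eq_vec_def)
  have "v = 0" if "(mat 1 - A) *v v = 0" for v
  proof -
    have "A *v v = v" using that by (simp add: matrix_vector_mult_diff_rdistrib)
    then have "\<bar>v\<bar> \<le> A *v \<bar>v\<bar>" using abs_matrix_vector_le[of A v] by simp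
    moreover have "0 \<le> \<bar>v\<bar>" by (simp add: less_eq_vec_def abs_vec_def)
    ultimately have "\<bar>v\<bar> = 0" using subinvariant_vector_eq_0[OF A] by blast
    then show ?thesis by (simp add: vec_eq_iff abs_vec_def)
  qed
  then have "invertible (mat 1 - A)"
    using matrix_left_invertible_ker invertible_left_inverse by blast
  then obtain B where "(mat 1 - A) ** B = mat 1" unfolding invertible_def by blast
  then have "(mat 1 - A) *v (B *v a) = a" by (simp add: matrix_vector_mul_assoc)
  then obtain v where "(mat 1 - A) *v v = a" by blast
  then have v: "v = A *v v + a"
    by (simp add: matrix_vector_mult_diff_rdistrib algebra_simps)
  \<comment> \<open>The negative part of \<open>v\<close>. As \<open>a \<ge> 0\<close>,
    \<open>- v \<le> - (A v) \<le> A n\<close>; together with \<open>0 \<le> A n\<close> this gives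
    \<open>n \<le> A n\<close>.\<close>
  define n where "n = (\<chi> i. max 0 (- v $ i))"
  have n: "0 \<le> n" "- v \<le> n" by (auto simp: n_def less_eq_vec_def)
  have "- (A *v v) = A *v (- v)" by (simp add: vec.neg matrix_vector_mult_def vec_eq_iff sum_negf)
  also have "\<dots> \<le> A *v n" by (rule nonneg_matrix_vector_mono[OF A(1) n(2)])
  finally have le: "- (A *v v) \<le> A *v n" .
  have nonneg: "0 \<le> A *v n" using nonneg_matrix_vector_mono[OF A(1) n(1)] by simp
  have "- v $ i \<le> (A *v n) $ i" for i
  proof -
    have "v $ i = (A *v v) $ i + a $ i" using arg_cong[OF v, of "\<lambda>x. x $ i"] by simp
    moreover have "- ((A *v v) $ i) \<le> (A *v n) $ i" "0 \<le> a $ i"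
      using le assms(3) by (simp_all add: less_eq_vec_def)
    ultimately show ?thesis by linarith
  qed
  then have "n \<le> A *v n" using nonneg by (auto simp: less_eq_vec_def n_def)
  then have "n = 0" using subinvariant_vector_eq_0[OF A n(1)] by blast
  then have "0 \<le> v" using n(2) by (auto simp: less_eq_vec_def)
  then show thesis using v that by blast
qed

section \<open>Well-posedness of the implicit controller\<close>

text \<open>The offset \<open>b\<close> cancels in the difference \<open>d\<close> of two solutions,
  and nonexpansiveness leaves \<open>\<bar>d\<bar> \<le> \<bar>W\<bar> \<bar>d\<bar>\<close>, so
  \<open>d\<close> vanishes by subinvariance.\<close>

lemma implicit_equation_unique:
  fixes W :: "real ^ 'q ^ 'q"
  assumes ne: "componentwise_nonexpansive \<phi> \<phi>c" and W: "lambda_pf \<bar>W\<bar> < 1"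
    and "\<eta> = \<phi> (W *v \<eta> + b)" and "\<zeta> = \<phi> (W *v \<zeta> + b)"
  shows "\<eta> = \<zeta>"
proof -
  have nn: "0 \<le> \<bar>W\<bar>" "0 \<le> \<bar>\<eta> - \<zeta>\<bar>" by (simp_all add: less_eq_vec_def abs_vec_def)
  have "\<bar>\<eta> - \<zeta>\<bar> = \<bar>\<phi> (W *v \<eta> + b) - \<phi> (W *v \<zeta> + b)\<bar>" using assms(3,4) by simp
  also have "\<dots> \<le> \<bar>(W *v \<eta> + b) - (W *v \<zeta> + b)\<bar>"
    using ne unfolding componentwise_nonexpansive_def by blast
  also have "\<dots> = \<bar>W *v (\<eta> - \<zeta>)\<bar>" by (simp add: matrix_vector_mult_diff_distrib)
  also have "\<dots> \<le> \<bar>W\<bar> *v \<bar>\<eta> - \<zeta>\<bar>" by (rule abs_matrix_vector_le)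
  finally have "\<bar>\<eta> - \<zeta>\<bar> = 0" using subinvariant_vector_eq_0[OF nn(1) W nn(2)] by blast
  then show ?thesis by (simp add: vec_eq_iff abs_vec_def)
qed

text \<open>With \<open>v = \<bar>W\<bar> v + \<bar>\<phi> b\<bar>\<close>, the map sends the box \<open>\<bar>\<eta>\<bar> \<le> v\<close> to itself, so Brouwer applies.\<close>

lemma implicit_equation_solvable:
  fixes W :: "real ^ 'q ^ 'q"
  assumes ne: "componentwise_nonexpansive \<phi> \<phi>c" and W: "lambda_pf \<bar>W\<bar> < 1"
  shows "\<exists>\<eta>. \<eta> = \<phi> (W *v \<eta> + b)"
proof -
  have nn: "0 \<le> \<bar>W\<bar>" "0 \<le> \<bar>\<phi> b\<bar>" by (simp_all add: less_eq_vec_def abs_vec_def)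
  obtain v where v: "0 \<le> v" "v = \<bar>W\<bar> *v v + \<bar>\<phi> b\<bar>"
    using nonneg_resolvent[OF nn(1) W nn(2)] by blast
  have lip: "\<bar>\<phi> r - \<phi> s\<bar> \<le> \<bar>r - s\<bar>" for r s
    using ne unfolding componentwise_nonexpansive_def by blast
  \<comment> \<open>Componentwise domination passes to the Euclidean norm, so \<phi> is 1-Lipschitz
    and hence continuous, as Brouwer's theorem requires.\<close>
  have "dist (\<phi> r) (\<phi> s) \<le> 1 * dist r s" for r s
    using lip[of r s] unfolding dist_norm
    by (auto simp: less_eq_vec_def abs_vec_def intro!: norm_le_componentwise_cart)
  then have "continuous_on UNIV \<phi>"
    by (intro lipschitz_on_continuous_on[of 1]) (auto intro: lipschitz_onI)
  moreover have "continuous_on UNIV (\<lambda>\<eta>. W *v \<eta> + b)"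
    by (intro continuous_intros linear_continuous_on matrix_vector_mul_bounded_linear)
  ultimately have cont: "continuous_on (cbox (- v) v) (\<lambda>\<eta>. \<phi> (W *v \<eta> + b))"
    using continuous_on_compose2 continuous_on_subset subset_UNIV by metis
  have "\<phi> (W *v \<eta> + b) \<in> cbox (- v) v" if "\<eta> \<in> cbox (- v) v" for \<eta>
  proof -
    have \<eta>: "\<bar>\<eta>\<bar> \<le> v"
      using that by (auto simp: mem_box_cart less_eq_vec_def abs_vec_def abs_le_iff minus_le_iff)
    \<comment> \<open>The comparison point \<open>\<phi> b\<close> is the value of the map at 0; its
      size is the inhomogeneity in the equation for \<open>v\<close>.\<close>
    have "\<bar>\<phi> (W *v \<eta> + b) - \<phi> b\<bar> \<le> \<bar>W *v \<eta>\<bar>" using lip[of "W *v \<eta> + b" b] by simp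
    also have "\<dots> \<le> \<bar>W\<bar> *v \<bar>\<eta>\<bar>" by (rule abs_matrix_vector_le)
    also have "\<dots> \<le> \<bar>W\<bar> *v v" by (rule nonneg_matrix_vector_mono[OF nn(1) \<eta>])
    finally have le: "\<bar>\<phi> (W *v \<eta> + b) - \<phi> b\<bar> \<le> \<bar>W\<bar> *v v" .
    have "\<bar>\<phi> (W *v \<eta> + b) $ i\<bar> \<le> v $ i" for i
    proof -
      have "v $ i = (\<bar>W\<bar> *v v) $ i + \<bar>\<phi> b $ i\<bar>"
        using arg_cong[OF v(2), of "\<lambda>x. x $ i"] by (simp add: abs_vec_def)
      moreover have "\<bar>\<phi> (W *v \<eta> + b) $ i - \<phi> b $ i\<bar> \<le> (\<bar>W\<bar> *v v) $ i"
        using le by (simp add: less_eq_vec_def abs_vec_def)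
      ultimately show ?thesis by linarith
    qed
    then show ?thesis by (simp add: mem_box_cart abs_le_iff minus_le_iff)
  qed
  then have maps: "(\<lambda>\<eta>. \<phi> (W *v \<eta> + b)) \<in> cbox (- v) v \<rightarrow> cbox (- v) v" by blast
  have "0 \<in> cbox (- v) v" using v(1) by (simp add: mem_box_cart less_eq_vec_def)
  then have "cbox (- v) v \<noteq> {}" by blast
  then obtain \<eta> where "\<phi> (W *v \<eta> + b) = \<eta>"
    using brouwer[OF compact_cbox convex_box(1) _ cont maps] by blast
  then show ?thesis by metis
qed

lemma implicit_output_eqI:
  assumes "componentwise_nonexpansive \<phi> \<phi>c" and "lambda_pf \<bar>W\<bar> < 1"
    and "\<eta> = \<phi> (W *v \<eta> + U *v y)"
  shows "implicit_output U W \<phi> y = \<eta>"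
  unfolding implicit_output_def
  using assms(3) implicit_equation_unique[OF assms(1,2)] by (intro the_equality) metis+

lemma implicit_output_solves:
  assumes "componentwise_nonexpansive \<phi> \<phi>c" and "lambda_pf \<bar>W\<bar> < 1"
  shows "implicit_output U W \<phi> y = \<phi> (W *v implicit_output U W \<phi> y + U *v y)"
  using implicit_equation_solvable[OF assms] implicit_output_eqI[OF assms] by metis

section \<open>Dissipation along the closed loop\<close>

text \<open>The stacked vector of state and activation, matching the columns of
  \<open>block_row\<close>; the matrix inequality is tested on such vectors.\<close>

definition join :: "real ^ 'a \<Rightarrow> real ^ 'b \<Rightarrow> real ^ ('a + 'b)" where
  "join x y = (\<chi> j. case j of Inl a \<Rightarrow> x $ a | Inr b \<Rightarrow> y $ b)"

lemma block_row_mult_join: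
  fixes A :: "real ^ 'a ^ 'c" and B :: "real ^ 'b ^ 'c"
  shows "block_row A B *v join x y = A *v x + B *v y"
proof -
  have "(\<Sum>j\<in>UNIV. f j) = (\<Sum>a\<in>UNIV. f (Inl a)) + (\<Sum>b\<in>UNIV. f (Inr b))"
    for f :: "'a + 'b \<Rightarrow> real"
    by (subst UNIV_Plus_UNIV[symmetric], subst sum.Plus) auto
  then show ?thesis
    by (simp add: vec_eq_iff matrix_vector_mult_def block_row_def join_def)
qed

lemma inner_transpose_mult:
  fixes A :: "real ^ 'a ^ 'b"
  shows "x \<bullet> (transpose A *v y) = (A *v x) \<bullet> y"
  by (metis dot_lmul_matrix inner_commute transpose_matrix_vector)

lemma diagonal_mult_component:
  fixes D :: "real ^ 'a ^ 'a"
  assumes "is_diagonal D"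
  shows "(D *v v) $ i = D $ i $ i * v $ i"
proof -
  have "(D *v v) $ i = (\<Sum>j\<in>UNIV. if j = i then D $ i $ i * v $ i else 0)"
    using assms unfolding matrix_vector_mult_def is_diagonal_def vec_lambda_beta
    by (intro sum.cong refl) auto
  then show ?thesis by simp
qed

lemma pos_semidef_diagonal_nonneg:
  assumes "pos_semidef A"
  shows "0 \<le> A $ i $ i"
proof -
  have "0 \<le> axis i 1 \<bullet> (A *v axis i 1)" using assms by (simp add: pos_semidef_def)
  also have "\<dots> = A $ i $ i" by (simp add: inner_axis' matrix_vector_mult_basis column_def)
  finally show ?thesis .
qed

text \<open>At the stacked vector, \<open>H\<close> returns \<eta> and \<open>Z\<close> returns
  \<open>z\<close>. Diagonality decouples the components, and each summand factors into the product
  from the sector condition.\<close>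

lemma sector_multiplier_form:
  fixes Z :: "real ^ ('n::finite + 'q) ^ 'q"
  assumes "is_diagonal D\<^sub>0" "is_diagonal D\<^sub>1" "is_diagonal \<Lambda>"
    and z: "z = Z *v join x \<eta>"
  shows "join x \<eta> \<bullet> (sector_multiplier D\<^sub>0 D\<^sub>1 \<Lambda> Z *v join x \<eta>) =
    (\<Sum>i\<in>UNIV. 2 * \<Lambda> $ i $ i * ((\<eta> $ i - D\<^sub>0 $ i $ i * z $ i) * (D\<^sub>1 $ i $ i * z $ i - \<eta> $ i)))"
proof -
  have H: "activation_selector *v join x \<eta> = \<eta>"
    by (simp add: activation_selector_def block_row_mult_join)
  \<comment> \<open>A matrix and its transpose have the same quadratic form, so \<open>He\<close>
    doubles the cross term.\<close>
  have T: "v \<bullet> (transpose Y *v v) = v \<bullet> (Y *v v)" for v and Y :: "real ^ ('n + 'q) ^ ('n + 'q)"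
    by (simp only: inner_transpose_mult inner_commute)
  have "join x \<eta> \<bullet> (sector_multiplier D\<^sub>0 D\<^sub>1 \<Lambda> Z *v join x \<eta>) =
     - 2 * (z \<bullet> (D\<^sub>0 *v (\<Lambda> *v (D\<^sub>1 *v z)))) + 2 * (\<eta> \<bullet> (\<Lambda> *v ((D\<^sub>0 + D\<^sub>1) *v z))) - 2 * (\<eta> \<bullet> (\<Lambda> *v \<eta>))"
    unfolding sector_multiplier_def Let_def He_def
      matrix_vector_mult_diff_rdistrib matrix_vector_mult_add_rdistrib inner_diff_right inner_add_right T
      scaleR_matrix_vector_assoc[symmetric] inner_scaleR_right matrix_vector_mul_assoc[symmetric]
      inner_transpose_mult H z[symmetric]
    by simp
  also have "\<dots> = (\<Sum>i\<in>UNIV. 2 * \<Lambda> $ i $ i * ((\<eta> $ i - D\<^sub>0 $ i $ i * z $ i) * (D\<^sub>1 $ i $ i * z $ i - \<eta> $ i)))"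
    by (simp add: inner_vec_def diagonal_mult_component[OF assms(1)] diagonal_mult_component[OF assms(2)]
        diagonal_mult_component[OF assms(3)] matrix_vector_mult_add_rdistrib
        sum_distrib_left sum.distrib[symmetric] sum_subtractf[symmetric] sum_negf[symmetric])
      (intro sum.cong refl, simp add: algebra_simps)
  finally show ?thesis .
qed

lemma dissipation_step:
  fixes P :: "real ^ 'n::finite ^ 'n" and Z :: "real ^ ('n + 'q) ^ 'q" and F :: "real ^ ('n + 'q) ^ 'n"
  assumes \<phi>: "acts_componentwise \<phi> \<phi>c" and sec: "static_sector_condition \<phi> \<phi>c D\<^sub>0 D\<^sub>1"
    and \<Lambda>: "is_diagonal \<Lambda>" "pos_semidef \<Lambda>"
    and lmi: "transpose F ** P ** F - \<rho>\<^sup>2 *\<^sub>R (transpose state_selector ** P ** state_selector)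
      + sector_multiplier D\<^sub>0 D\<^sub>1 \<Lambda> Z \<preceq>\<^sub>L 0"
    and \<eta>: "\<eta> = \<phi> (Z *v join x \<eta>)"
  shows "(F *v join x \<eta>) \<bullet> (P *v (F *v join x \<eta>)) \<le> \<rho>\<^sup>2 * (x \<bullet> (P *v x))"
proof -
  define z where "z = Z *v join x \<eta>"
  have \<eta>i: "\<eta> $ i = \<phi>c i (z $ i)" for i
    using \<eta> \<phi> unfolding acts_componentwise_def z_def by metis
  have X: "state_selector *v join x \<eta> = x"
    by (simp add: state_selector_def block_row_mult_join)
  have "0 \<le> join x \<eta> \<bullet> (sector_multiplier D\<^sub>0 D\<^sub>1 \<Lambda> Z *v join x \<eta>)"
    using sec pos_semidef_diagonal_nonneg[OF \<Lambda>(2)] unfolding static_sector_condition_def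
    by (subst sector_multiplier_form[OF _ _ \<Lambda>(1) z_def]) (auto intro!: sum_nonneg simp: \<eta>i)
  moreover have "join x \<eta> \<bullet> ((transpose F ** P ** F - \<rho>\<^sup>2 *\<^sub>R (transpose state_selector ** P ** state_selector)
      + sector_multiplier D\<^sub>0 D\<^sub>1 \<Lambda> Z) *v join x \<eta>) \<le> 0"
  proof -
    have "0 \<le> join x \<eta> \<bullet> ((0 - (transpose F ** P ** F - \<rho>\<^sup>2 *\<^sub>R (transpose state_selector ** P ** state_selector)
      + sector_multiplier D\<^sub>0 D\<^sub>1 \<Lambda> Z)) *v join x \<eta>)"
      using lmi unfolding semidef_le_def pos_semidef_def by blast
    then show ?thesis
      by (subst (asm) matrix_vector_mult_diff_rdistrib) (simp add: inner_diff_right)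
  qed
  ultimately show ?thesis
    unfolding matrix_vector_mult_diff_rdistrib matrix_vector_mult_add_rdistrib inner_diff_right inner_add_right
      scaleR_matrix_vector_assoc[symmetric] inner_scaleR_right matrix_vector_mul_assoc[symmetric]
      inner_transpose_mult X
    by linarith
qed

section \<open>Quadratic Lyapunov functions and exponential decay\<close>

lemma pos_def_coercive:
  fixes P :: "real ^ 'n ^ 'n"
  assumes "pos_def P"
  obtains a where "0 < a" and "\<And>v. a * (norm v)\<^sup>2 \<le> v \<bullet> (P *v v)"
proof -
  have "continuous_on (sphere 0 1) (\<lambda>v. v \<bullet> (P *v v))"
    by (intro continuous_intros linear_continuous_on matrix_vector_mul_bounded_linear)
  moreover have "sphere (0 :: real ^ 'n) 1 \<noteq> {}" by simp
  \<comment> \<open>The constant is the minimum of the form on the compact unit sphere; homogeneity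
    of degree two extends the bound to all vectors.\<close>
  ultimately obtain w where w: "norm w = 1"
    and min: "\<And>v. norm v = 1 \<Longrightarrow> w \<bullet> (P *v w) \<le> v \<bullet> (P *v v)"
    using continuous_attains_inf[OF compact_sphere, of 0 1 "\<lambda>v. v \<bullet> (P *v v)"] by auto
  have "w \<noteq> 0" using w by auto
  then have pos: "0 < w \<bullet> (P *v w)" using assms unfolding pos_def_def by blast
  have "w \<bullet> (P *v w) * (norm v)\<^sup>2 \<le> v \<bullet> (P *v v)" for v
  proof (cases "v = 0")
    case False
    have "w \<bullet> (P *v w) \<le> ((1 / norm v) *\<^sub>R v) \<bullet> (P *v ((1 / norm v) *\<^sub>R v))"
      using False by (intro min) simp
    also have "\<dots> = v \<bullet> (P *v v) / (norm v)\<^sup>2"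
      by (simp add: matrix_vector_mult_scaleR power2_eq_square)
    finally show ?thesis using False by (simp add: field_simps)
  qed simp
  with pos that show thesis by blast
qed

lemma quadratic_form_bounded:
  fixes P :: "real ^ 'n ^ 'n"
  obtains b where "0 < b" and "\<And>v. v \<bullet> (P *v v) \<le> b * (norm v)\<^sup>2"
proof -
  obtain b where b: "0 < b" "\<And>v. norm (P *v v) \<le> norm v * b"
    using bounded_linear.pos_bounded[OF matrix_vector_mul_bounded_linear[of P]] by blast
  have "v \<bullet> (P *v v) \<le> b * (norm v)\<^sup>2" for v
  proof -
    have "v \<bullet> (P *v v) \<le> norm v * norm (P *v v)" by (rule norm_cauchy_schwarz)
    also have "\<dots> \<le> norm v * (norm v * b)" by (intro mult_left_mono b) simp
    finally show ?thesis by (simp add: power2_eq_square mult_ac)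
  qed
  with b(1) that show thesis by blast
qed

lemma quadratic_decay:
  fixes x :: "nat \<Rightarrow> real ^ 'n"
  assumes "\<And>k. x (Suc k) \<bullet> (P *v x (Suc k)) \<le> \<rho>\<^sup>2 * (x k \<bullet> (P *v x k))"
  shows "x k \<bullet> (P *v x k) \<le> \<rho> ^ (2 * k) * (x 0 \<bullet> (P *v x 0))"
proof (induction k)
  case (Suc k)
  have "x (Suc k) \<bullet> (P *v x (Suc k)) \<le> \<rho>\<^sup>2 * (x k \<bullet> (P *v x k))" by (rule assms)
  also have "\<dots> \<le> \<rho>\<^sup>2 * (\<rho> ^ (2 * k) * (x 0 \<bullet> (P *v x 0)))" by (intro mult_left_mono Suc) simp
  finally show ?case by (simp add: power2_eq_square mult_ac)
qed simp

text \<open>The form lies between \<open>a\<close> and \<open>b\<close> times the squared norm, so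
  its decay passes to the norm with overshoot constant \<open>sqrt (b / a)\<close>.\<close>

lemma exponentially_stable_of_quadratic_decay:
  assumes P: "pos_def P" and "0 \<le> \<rho>" "\<rho> < 1" and f0: "f 0 = 0"
    and step: "\<And>x. f x \<bullet> (P *v f x) \<le> \<rho>\<^sup>2 * (x \<bullet> (P *v x))"
  shows "origin_globally_exponentially_stable f"
proof -
  obtain a where a: "0 < a" "\<And>v. a * (norm v)\<^sup>2 \<le> v \<bullet> (P *v v)" using pos_def_coercive[OF P] by blast
  obtain b where b: "0 < b" "\<And>v. v \<bullet> (P *v v) \<le> b * (norm v)\<^sup>2" using quadratic_form_bounded by blast
  \<comment> \<open>The definition of stability demands a strictly positive rate, so \<open>\<rho> = 0\<close> needs room.\<close>
  define \<gamma> where "\<gamma> = max \<rho> (1 / 2)"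
  have "norm (x k) \<le> sqrt (b / a) * \<gamma> ^ k * norm (x 0)" if x: "\<forall>k. x (Suc k) = f (x k)" for x k
  proof -
    have "a * (norm (x k))\<^sup>2 \<le> x k \<bullet> (P *v x k)" by (rule a)
    also have "\<dots> \<le> \<rho> ^ (2 * k) * (x 0 \<bullet> (P *v x 0))"
      by (rule quadratic_decay) (simp add: x step)
    also have "\<dots> \<le> \<gamma> ^ (2 * k) * (b * (norm (x 0))\<^sup>2)"
    proof (rule mult_mono)
      show "\<rho> ^ (2 * k) \<le> \<gamma> ^ (2 * k)" using \<open>0 \<le> \<rho>\<close> by (intro power_mono) (auto simp: \<gamma>_def)
      show "0 \<le> x 0 \<bullet> (P *v x 0)" using a(2)[of "x 0"] a(1) by (smt (verit) mult_nonneg_nonneg zero_le_power2)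
    qed (use b in \<open>auto simp: \<gamma>_def\<close>)
    finally have "(norm (x k))\<^sup>2 \<le> b / a * (\<gamma> ^ k)\<^sup>2 * (norm (x 0))\<^sup>2"
      using a(1) by (simp add: field_simps power_mult power2_eq_square flip: power_mult_distrib)
    also have "\<dots> = (sqrt (b / a) * \<gamma> ^ k * norm (x 0))\<^sup>2"
      using a(1) b(1) by (simp add: power_mult_distrib)
    finally show ?thesis
      by (rule power2_le_imp_le) (use a b in \<open>auto simp: \<gamma>_def intro!: mult_nonneg_nonneg\<close>)
  qed
  moreover have "0 < sqrt (b / a)" "0 < \<gamma>" "\<gamma> < 1"
    using a(1) b(1) \<open>\<rho> < 1\<close> by (auto simp: \<gamma>_def)
  ultimately show ?thesis
    unfolding origin_globally_exponentially_stable_def using f0 by blast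
qed

theorem theorem2:
  fixes A\<^sub>p :: "real ^ 'n ^ 'n" and B\<^sub>p :: "real ^ 'm ^ 'n" and C\<^sub>p :: "real ^ 'n ^ 'p"
    and K :: "real ^ 'p ^ 'm" and U :: "real ^ 'p ^ 'q" and V :: "real ^ 'q ^ 'm"
    and W :: "real ^ 'q ^ 'q"
    and \<phi> :: "real ^ 'q \<Rightarrow> real ^ 'q" and \<phi>c :: "'q \<Rightarrow> real \<Rightarrow> real"
    and D\<^sub>0 D\<^sub>1 \<Lambda> :: "real ^ 'q ^ 'q" and P :: "real ^ 'n ^ 'n" and \<rho> :: real
    and X :: "real ^ ('n + 'q) ^ 'n" and Z :: "real ^ ('n + 'q) ^ 'q"
    and F :: "real ^ ('n + 'q) ^ 'n"
  defines "X \<equiv> state_selector"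
    and "Z \<equiv> block_row (U ** C\<^sub>p) W"
    and "F \<equiv> block_row (A\<^sub>p + B\<^sub>p ** K ** C\<^sub>p) (B\<^sub>p ** V)"
  assumes "componentwise_nonexpansive \<phi> \<phi>c"
    and "static_sector_condition \<phi> \<phi>c D\<^sub>0 D\<^sub>1"
    and "lambda_pf \<bar>W\<bar> < 1"
    and "pos_def P"
    and "is_diagonal \<Lambda>" and "pos_semidef \<Lambda>"
    and "0 \<le> \<rho>" and "\<rho> < 1"
    and "transpose F ** P ** F - \<rho>\<^sup>2 *\<^sub>R (transpose X ** P ** X) + sector_multiplier D\<^sub>0 D\<^sub>1 \<Lambda> Z \<preceq>\<^sub>L 0"
  shows "origin_globally_exponentially_stable (closed_loop_map A\<^sub>p B\<^sub>p C\<^sub>p K U V W \<phi>) \<and>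
    (\<forall>x u y \<eta>. closed_loop_trajectory A\<^sub>p B\<^sub>p C\<^sub>p K U V W \<phi> x u y \<eta> \<longrightarrow>
       (\<forall>k. x k \<bullet> (P *v x k) \<le> \<rho> ^ (2 * k) * (x 0 \<bullet> (P *v x 0))))"
proof -
  \<comment> \<open>Stated for an arbitrary solution \<eta>, so that it covers both
    \<open>closed_loop_map\<close> and the signals of a given trajectory.\<close>
  have step: "x' \<bullet> (P *v x') \<le> \<rho>\<^sup>2 * (x \<bullet> (P *v x))"
    if \<eta>: "\<eta> = \<phi> (W *v \<eta> + U *v (C\<^sub>p *v x))"
      and x': "x' = A\<^sub>p *v x + B\<^sub>p *v (K *v (C\<^sub>p *v x) + V *v \<eta>)" for x x' \<eta>
  proof -
    have "Z *v join x \<eta> = W *v \<eta> + U *v (C\<^sub>p *v x)"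
      by (simp add: Z_def block_row_mult_join matrix_vector_mul_assoc add.commute)
    moreover have "F *v join x \<eta> = x'"
      by (simp add: F_def block_row_mult_join x' matrix_vector_right_distrib
          matrix_vector_mult_add_rdistrib matrix_vector_mul_assoc matrix_mul_assoc)
    ultimately show ?thesis
      using dissipation_step[OF _ assms(5,8,9) assms(12)[unfolded X_def], of \<eta> x] assms(4) \<eta>
      by (simp add: componentwise_nonexpansive_def)
  qed
  \<comment> \<open>Since \<open>\<phi> 0 = 0\<close>, zero solves the fixed-point equation at
    output 0, and uniqueness selects it; hence the origin is an equilibrium.\<close>
  have "implicit_output U W \<phi> 0 = 0"
    using assms(5) by (intro implicit_output_eqI[OF assms(4,6)]) (simp add: static_sector_condition_def)
  then have "closed_loop_map A\<^sub>p B\<^sub>p C\<^sub>p K U V W \<phi> 0 = 0" by (simp add: closed_loop_map_def)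
  moreover have "closed_loop_map A\<^sub>p B\<^sub>p C\<^sub>p K U V W \<phi> x \<bullet> (P *v closed_loop_map A\<^sub>p B\<^sub>p C\<^sub>p K U V W \<phi> x)
      \<le> \<rho>\<^sup>2 * (x \<bullet> (P *v x))" for x
    by (rule step[OF implicit_output_solves[OF assms(4,6)] closed_loop_map_def])
  ultimately have "origin_globally_exponentially_stable (closed_loop_map A\<^sub>p B\<^sub>p C\<^sub>p K U V W \<phi>)"
    using exponentially_stable_of_quadratic_decay[OF assms(7,10,11)] by blast
  moreover have "x k \<bullet> (P *v x k) \<le> \<rho> ^ (2 * k) * (x 0 \<bullet> (P *v x 0))"
    if "closed_loop_trajectory A\<^sub>p B\<^sub>p C\<^sub>p K U V W \<phi> x u y \<eta>" for x u y \<eta> k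
  proof (rule quadratic_decay)
    fix j
    show "x (Suc j) \<bullet> (P *v x (Suc j)) \<le> \<rho>\<^sup>2 * (x j \<bullet> (P *v x j))"
      by (rule step[of "\<eta> j"]) (use that in \<open>metis closed_loop_trajectory_def\<close>)+
  qed
  ultimately show ?thesis by blast
qed

end
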